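(* Let $\alpha,\beta$ be positive constants, and consider a general rotational surface of first or second type in the Minkowski space $\mathbb{R}^4_1$ determined by smooth functions $f,g$ on an open interval $J$ and by $\alpha,\beta$. This surface consists of parabolic points if and only if it is one of the following: (i) a developable ruled surface in $\mathbb{R}^4_1$; (ii) a non-developable ruled surface in $\mathbb{R}^4_1$; (iii) a non-ruled surface in $\mathbb{R}^4_1$ whose meridian curve is given by $f(u) = u,\ g(u) = c\,u^{-\frac{\beta^2}{\alpha^2}}$, where $c$ is a non-zero constant.
   Context: $\mathbb{R}^4_1$ is $\mathbb{R}^4$ with the metric $\langle x,y\rangle=x_1y_1+x_2y_2+x_3y_3-x_4y_4$. A surface in $\mathbb{R}^4_1$ is spacelike if the induced metric is Riemannian. The general rotational surface of first type is the spacelike surface $$\mathcal{M}_1:\ z(u,v)=\left(f(u)\cos\alpha v,\ f(u)\sin\alpha v,\ g(u)\cosh\beta v,\ g(u)\sinh\beta v\right),\quad u\in J,\ v\in[0,2\pi),$$ where $f,g$ are smooth with $\alpha^2 f^2-\beta^2 g^2>0$ and $f'^2+g'^2>0$ on $J$. The general rotational surface of second type is the spacelike surface $$\mathcal{M}_2:\ z(u,v)=\left(f(u)\cos\alpha v,\ f(u)\sin\alpha v,\ g(u)\sinh\beta v,\ g(u)\cosh\beta v\right),\quad u\in J,\ v\in[0,2\pi),$$ where $f,g$ are smooth with $f'^2-g'^2>0$ and $\alpha^2 f^2+\beta^2 g^2>0$ on $J$. The parametric curves $v=\mathrm{const}$ are the meridians; the meridian curve is represented by the plane curve $u\mapsto(f(u),g(u))$.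 That the meridian curve is given by certain functions is understood up to regular reparametrization and up to replacing $f$ by $-f$ (which changes the surface only by a rotation by the angle $\pi$ in the $e_1e_2$-plane). Invariant $k$ and parabolic points: for a spacelike surface $z=z(u,v)$ with $E=\langle z_u,z_u\rangle$, $F=\langle z_u,z_v\rangle$, $G=\langle z_v,z_v\rangle$, $W=\sqrt{EG-F^2}$, choose a normal frame $\{n_1,n_2\}$ with $\langle n_1,n_1\rangle=1$, $\langle n_2,n_2\rangle=-1$, $\langle n_1,n_2\rangle=0$ and $\{z_u,z_v,n_1,n_2\}$ positively oriented, and put $c_{11}^k=\langle z_{uu},n_k\rangle$, $c_{12}^k=\langle z_{uv},n_k\rangle$, $c_{22}^k=\langle z_{vv},n_k\rangle$ ($k=1,2$) and $$L=\tfrac{2}{W}(c_{11}^1c_{12}^2-c_{12}^1c_{11}^2),\quad M=\tfrac{1}{W}(c_{11}^1c_{22}^2-c_{22}^1c_{11}^2),\quad N=\tfrac{2}{W}(c_{12}^1c_{22}^2-c_{22}^1c_{12}^2).$$ The function $k=\dfrac{LN-M^2}{EG-F^2}$ does not depend on the choice of parameters and normal frame. A point is parabolic if $k=0$ there; the surface consists of parabolic points if $k$ vanishes identically. A ruled surface is a surface foliated by (open pieces of) straight lines, the rulings; it is developable if its tangent plane is constant along each ruling, and non-developable otherwise. *)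

theory Defs
  imports "HOL-Analysis.Analysis"
begin

text \<open>
  A parametrised surface is a map of the parameters \<open>(u, v)\<close> into \<open>real^4\<close>, together with a
  parameter domain \<open>D\<close>, here \<open>J \<times> [0, 2 pi)\<close>.  The maps considered are given by formulas that
  make sense for every real \<open>v\<close>, so the partial derivatives below are two-sided also
  at \<open>v = 0\<close>.
\<close>

type_synonym surface = "real \<times> real \<Rightarrow> real^4"

definition minkowski :: "real^4 \<Rightarrow> real^4 \<Rightarrow> real" where
  "minkowski x y = x$1 * y$1 + x$2 * y$2 + x$3 * y$3 - x$4 * y$4"

definition smooth_on :: "(real \<Rightarrow> real) \<Rightarrow> real set \<Rightarrow> bool" where
  "smooth_on f S \<longleftrightarrow> (\<forall>n. \<forall>x\<in>S. ((deriv ^^ n) f) differentiable (at x))"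

definition partial_u :: "surface \<Rightarrow> surface" where
  "partial_u z p = vector_derivative (\<lambda>s. z (s, snd p)) (at (fst p))"

definition partial_v :: "surface \<Rightarrow> surface" where
  "partial_v z p = vector_derivative (\<lambda>s. z (fst p, s)) (at (snd p))"


section \<open>General rotational surfaces\<close>

definition rotational1 :: "real \<Rightarrow> real \<Rightarrow> (real \<Rightarrow> real) \<Rightarrow> (real \<Rightarrow> real) \<Rightarrow> surface" where
  "rotational1 \<alpha> \<beta> f g = (\<lambda>(u, v).
     vector [f u * cos (\<alpha> * v), f u * sin (\<alpha> * v), g u * cosh (\<beta> * v), g u * sinh (\<beta> * v)])"

definition rotational2 :: "real \<Rightarrow> real \<Rightarrow> (real \<Rightarrow> real) \<Rightarrow> (real \<Rightarrow> real) \<Rightarrow> surface" where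
  "rotational2 \<alpha> \<beta> f g = (\<lambda>(u, v).
     vector [f u * cos (\<alpha> * v), f u * sin (\<alpha> * v), g u * sinh (\<beta> * v), g u * cosh (\<beta> * v)])"

text \<open>
  Here \<open>F = 0\<close> holds automatically, and the inequalities say that \<open>E > 0\<close> and \<open>G > 0\<close>, i.e. that
  the surface is spacelike.
\<close>

definition general_rotational_first_type ::
    "real \<Rightarrow> real \<Rightarrow> real set \<Rightarrow> (real \<Rightarrow> real) \<Rightarrow> (real \<Rightarrow> real) \<Rightarrow> surface \<Rightarrow> bool" where
  "general_rotational_first_type \<alpha> \<beta> J f g z \<longleftrightarrow>
     smooth_on f J \<and> smooth_on g J \<and>
     (\<forall>u\<in>J. \<alpha>\<^sup>2 * (f u)\<^sup>2 - \<beta>\<^sup>2 * (g u)\<^sup>2 > 0 \<and> (deriv f u)\<^sup>2 + (deriv g u)\<^sup>2 > 0) \<and>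
     z = rotational1 \<alpha> \<beta> f g"

definition general_rotational_second_type ::
    "real \<Rightarrow> real \<Rightarrow> real set \<Rightarrow> (real \<Rightarrow> real) \<Rightarrow> (real \<Rightarrow> real) \<Rightarrow> surface \<Rightarrow> bool" where
  "general_rotational_second_type \<alpha> \<beta> J f g z \<longleftrightarrow>
     smooth_on f J \<and> smooth_on g J \<and>
     (\<forall>u\<in>J. (deriv f u)\<^sup>2 - (deriv g u)\<^sup>2 > 0 \<and> \<alpha>\<^sup>2 * (f u)\<^sup>2 + \<beta>\<^sup>2 * (g u)\<^sup>2 > 0) \<and>
     z = rotational2 \<alpha> \<beta> f g"

text \<open>
  The meridian curve \<open>u \<mapsto> (f u, g u)\<close>, \<open>u \<in> J\<close>, is given by the functions \<open>f0, g0\<close> (with domain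
  \<open>K\<close>) up to the sign of \<open>f\<close> and a regular change of parameter; \<open>\<phi>\<close> is a diffeomorphism
  of \<open>J\<close> onto the interval \<open>\<phi> ` J \<subseteq> K\<close> in which the new parameter ranges.
\<close>

definition meridian_given_by ::
    "(real \<Rightarrow> real) \<Rightarrow> (real \<Rightarrow> real) \<Rightarrow> real set \<Rightarrow>
     (real \<Rightarrow> real) \<Rightarrow> (real \<Rightarrow> real) \<Rightarrow> real set \<Rightarrow> bool" where
  "meridian_given_by f g J f0 g0 K \<longleftrightarrow>
     (\<exists>\<epsilon>\<in>{1, -1}. \<exists>\<phi>. smooth_on \<phi> J \<and> \<phi> ` J \<subseteq> K \<and> (\<forall>u\<in>J. deriv \<phi> u \<noteq> 0) \<and>
        (\<forall>u\<in>J. f u = \<epsilon> * f0 (\<phi> u) \<and> g u = g0 (\<phi> u)))"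


section \<open>The invariant \<open>k\<close>\<close>

definition E_coeff :: "surface \<Rightarrow> real \<times> real \<Rightarrow> real" where
  "E_coeff z p = minkowski (partial_u z p) (partial_u z p)"

definition F_coeff :: "surface \<Rightarrow> real \<times> real \<Rightarrow> real" where
  "F_coeff z p = minkowski (partial_u z p) (partial_v z p)"

definition G_coeff :: "surface \<Rightarrow> real \<times> real \<Rightarrow> real" where
  "G_coeff z p = minkowski (partial_v z p) (partial_v z p)"

definition W_coeff :: "surface \<Rightarrow> real \<times> real \<Rightarrow> real" where
  "W_coeff z p = sqrt (E_coeff z p * G_coeff z p - (F_coeff z p)\<^sup>2)"

definition normal_frame :: "surface \<Rightarrow> real \<times> real \<Rightarrow> (real^4) \<times> (real^4) \<Rightarrow> bool" where
  "normal_frame z p = (\<lambda>(n1, n2).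
     (\<forall>n\<in>{n1, n2}. minkowski (partial_u z p) n = 0 \<and> minkowski (partial_v z p) n = 0) \<and>
     minkowski n1 n1 = 1 \<and> minkowski n2 n2 = -1 \<and> minkowski n1 n2 = 0 \<and>
     det (vector [partial_u z p, partial_v z p, n1, n2] :: real^4^4) > 0)"

definition c11 :: "surface \<Rightarrow> real \<times> real \<Rightarrow> real^4 \<Rightarrow> real" where
  "c11 z p n = minkowski (partial_u (partial_u z) p) n"

definition c12 :: "surface \<Rightarrow> real \<times> real \<Rightarrow> real^4 \<Rightarrow> real" where
  "c12 z p n = minkowski (partial_v (partial_u z) p) n"

definition c22 :: "surface \<Rightarrow> real \<times> real \<Rightarrow> real^4 \<Rightarrow> real" where
  "c22 z p n = minkowski (partial_v (partial_v z) p) n"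

definition L_coeff :: "surface \<Rightarrow> real \<times> real \<Rightarrow> real^4 \<Rightarrow> real^4 \<Rightarrow> real" where
  "L_coeff z p n1 n2 = 2 / W_coeff z p * (c11 z p n1 * c12 z p n2 - c12 z p n1 * c11 z p n2)"

definition M_coeff :: "surface \<Rightarrow> real \<times> real \<Rightarrow> real^4 \<Rightarrow> real^4 \<Rightarrow> real" where
  "M_coeff z p n1 n2 = 1 / W_coeff z p * (c11 z p n1 * c22 z p n2 - c22 z p n1 * c11 z p n2)"

definition N_coeff :: "surface \<Rightarrow> real \<times> real \<Rightarrow> real^4 \<Rightarrow> real^4 \<Rightarrow> real" where
  "N_coeff z p n1 n2 = 2 / W_coeff z p * (c12 z p n1 * c22 z p n2 - c22 z p n1 * c12 z p n2)"

definition k_in_frame :: "surface \<Rightarrow> real \<times> real \<Rightarrow> (real^4) \<times> (real^4) \<Rightarrow> real" where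
  "k_in_frame z p = (\<lambda>(n1, n2).
     (L_coeff z p n1 n2 * N_coeff z p n1 n2 - (M_coeff z p n1 n2)\<^sup>2) /
     (E_coeff z p * G_coeff z p - (F_coeff z p)\<^sup>2))"

text \<open>At a point of a spacelike surface frames exist, and the value does not depend on the choice.\<close>

definition k_invariant :: "surface \<Rightarrow> real \<times> real \<Rightarrow> real" where
  "k_invariant z p = k_in_frame z p (SOME n. normal_frame z p n)"

definition parabolic_point :: "surface \<Rightarrow> real \<times> real \<Rightarrow> bool" where
  "parabolic_point z p \<longleftrightarrow> k_invariant z p = 0"

definition consists_of_parabolic_points :: "surface \<Rightarrow> (real \<times> real) set \<Rightarrow> bool" where
  "consists_of_parabolic_points z D \<longleftrightarrow> (\<forall>p\<in>D. parabolic_point z p)"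


section \<open>Ruled surfaces\<close>

text \<open>
  A leaf is an integral curve of the direction field \<open>X\<close>.  The interval \<open>I\<close> need not be open,
  because a leaf may end on the boundary line \<open>v = 0\<close> that belongs to \<open>J \<times> [0, 2 pi)\<close>.
\<close>

definition leaf_of :: "(real \<times> real \<Rightarrow> real \<times> real) \<Rightarrow> (real \<times> real) set \<Rightarrow> bool" where
  "leaf_of X R \<longleftrightarrow>
     (\<exists>I \<gamma>. is_interval I \<and> interior I \<noteq> {} \<and> \<gamma> ` I = R \<and>
        (\<forall>t\<in>I. (\<gamma> has_vector_derivative X (\<gamma> t)) (at t within I)))"

text \<open>
  \<open>\<R>\<close> is a foliation of the surface by pieces of straight lines: the leaves partition the
  parameter domain, their directions vary continuously, and \<open>z\<close> maps each leaf into a straight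
  line.  That leaves are closed in \<open>D\<close> prevents a ruling from being cut into several ones.
  A global field \<open>X\<close> (rather than a line field) is no restriction on a simply connected \<open>D\<close>.
\<close>

definition ruling_foliation ::
    "surface \<Rightarrow> (real \<times> real) set \<Rightarrow> (real \<times> real) set set \<Rightarrow> bool" where
  "ruling_foliation z D \<R> \<longleftrightarrow>
     partition_on D \<R> \<and>
     (\<exists>X. continuous_on D X \<and> (\<forall>p\<in>D. X p \<noteq> 0) \<and> (\<forall>R\<in>\<R>. leaf_of X R)) \<and>
     (\<forall>R\<in>\<R>. closedin (top_of_set D) R \<and> collinear (z ` R))"

definition ruled :: "surface \<Rightarrow> (real \<times> real) set \<Rightarrow> bool" where
  "ruled z D \<longleftrightarrow> (\<exists>\<R>. ruling_foliation z D \<R>)"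

definition tangent_plane :: "surface \<Rightarrow> real \<times> real \<Rightarrow> (real^4) set" where
  "tangent_plane z p = (\<lambda>w. z p + w) ` span {partial_u z p, partial_v z p}"

definition developable_ruled :: "surface \<Rightarrow> (real \<times> real) set \<Rightarrow> bool" where
  "developable_ruled z D \<longleftrightarrow>
     (\<exists>\<R>. ruling_foliation z D \<R> \<and>
        (\<forall>R\<in>\<R>. \<forall>p\<in>R. \<forall>q\<in>R. tangent_plane z p = tangent_plane z q))"

definition non_developable_ruled :: "surface \<Rightarrow> (real \<times> real) set \<Rightarrow> bool" where
  "non_developable_ruled z D \<longleftrightarrow> ruled z D \<and> \<not> developable_ruled z D"

end

theory Submission
  imports Defs
begin

text \<open>
  In a frame moved along by the one-parameter group of isometries generating the surface, the
  second fundamental form has only the entries \<open>P = f' g'' - f'' g'\<close>, \<open>Q = f' g - f g'\<close> and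
  \<open>R = \<alpha>\<^sup>2 f g' + \<beta>\<^sup>2 g f'\<close>, and \<open>k\<close> is a nonvanishing multiple of \<open>P Q\<^sup>2 R\<close>.  On an open set where
  \<open>Q = 0\<close> the meridian is a line through the origin, so \<open>k = 0\<close> everywhere forces \<open>P R = 0\<close>.
  Either \<open>P = 0\<close> throughout, and the straight meridians are rulings, or \<open>P \<noteq> 0\<close> somewhere; there
  \<open>R = 0\<close> integrates to a power curve, which has no inflection and hence stays curved on all
  of \<open>J\<close>.  Conversely, at a point of a ruling with direction \<open>(U, V)\<close> both components of the second
  fundamental form vanish, that is \<open>P U\<^sup>2 + R V\<^sup>2 = 0\<close> and \<open>Q U V = 0\<close>, whence \<open>P Q R = 0\<close>.
\<close>

section \<open>Linear algebra of the Minkowski product on \<open>real^4\<close>\<close>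

lemma vector_4 [simp]:
  fixes a :: "'a :: zero"
  shows "(vector [a, b, c, d] :: 'a^4) $ 1 = a" "(vector [a, b, c, d] :: 'a^4) $ 2 = b"
    "(vector [a, b, c, d] :: 'a^4) $ 3 = c" "(vector [a, b, c, d] :: 'a^4) $ 4 = d"
  unfolding vector_def by simp_all

lemma prod_4: "prod h (UNIV :: 4 set) = h 1 * h 2 * h 3 * h 4"
  unfolding UNIV_4 by (simp add: ac_simps)

lemma has_vector_derivative_vec4:
  fixes F :: "real \<Rightarrow> real^4"
  assumes "((\<lambda>t. F t $ 1) has_real_derivative D $ 1) (at x within A)"
    and "((\<lambda>t. F t $ 2) has_real_derivative D $ 2) (at x within A)"
    and "((\<lambda>t. F t $ 3) has_real_derivative D $ 3) (at x within A)"
    and "((\<lambda>t. F t $ 4) has_real_derivative D $ 4) (at x within A)"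
  shows "(F has_vector_derivative D) (at x within A)"
proof -
  have "\<forall>i. ((\<lambda>t. F t $ i) has_derivative (\<lambda>h. (h *\<^sub>R D) $ i)) (at x within A)"
    using assms unfolding forall_4
    by (simp add: has_real_derivative_iff_has_vector_derivative has_vector_derivative_def)
  then show ?thesis
    unfolding has_vector_derivative_def
    by (subst has_derivative_componentwise_within) (auto simp: Basis_vec_def inner_axis)
qed

lemma bounded_linear_minkowski: "bounded_linear (\<lambda>x. minkowski x n)"
proof -
  have "linear (\<lambda>x. minkowski x n)"
    by (intro linearI) (simp_all add: minkowski_def algebra_simps)
  then show ?thesis
    by (simp add: linear_conv_bounded_linear)
qed

lemma minkowski_scaleR [simp]:
  "minkowski (c *\<^sub>R x) y = c * minkowski x y" "minkowski x (c *\<^sub>R y) = c * minkowski x y"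
  by (simp_all add: minkowski_def algebra_simps)

lemma minkowski_add:
  "minkowski (x + y) w = minkowski x w + minkowski y w"
  "minkowski w (x + y) = minkowski w x + minkowski w y"
  by (simp_all add: minkowski_def algebra_simps)

lemma minkowski_commute: "minkowski x y = minkowski y x"
  by (simp add: minkowski_def)

lemma minkowski_minus [simp]: "minkowski (- x) y = - minkowski x y" "minkowski x (- y) = - minkowski x y"
  by (simp_all add: minkowski_def)

text \<open>The Gram matrix of the rows is \<open>A ** H ** transpose A\<close> with
  \<open>H\<close> the matrix of the metric; it is diagonal by orthogonality, and
  \<open>det H = -1\<close>.\<close>

lemma det_minkowski_orthogonal_rows:
  fixes A :: "real^4^4"
  assumes orth: "\<And>i j. i \<noteq> j \<Longrightarrow> minkowski (A $ i) (A $ j) = 0"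
  shows "(det A)\<^sup>2 = - (\<Prod>i\<in>UNIV. minkowski (A $ i) (A $ i))"
proof -
  define H :: "real^4^4" where "H = (\<chi> i j. if i = j then if i = 4 then -1 else 1 else 0)"
  have "A ** H ** transpose A = (\<chi> i j. minkowski (A $ i) (A $ j))"
    by (simp add: vec_eq_iff matrix_matrix_mult_def sum_4 H_def transpose_def minkowski_def)
  then have "det A * det H * det A = det (\<chi> i j. minkowski (A $ i) (A $ j) :: real^4^4)"
    by (metis det_mul det_transpose)
  also have "\<dots> = (\<Prod>i\<in>UNIV. minkowski (A $ i) (A $ i))"
    by (subst det_diagonal) (use orth in auto)
  also have "det H = -1"
    by (subst det_diagonal) (simp_all add: H_def prod_4)
  finally show ?thesis
    by (simp add: power2_eq_square)
qed

text \<open>Only the orientation is at stake. The Gram determinant shows that the four vectors are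
  independent, and replacing \<open>n1\<close> by \<open>- n1\<close> reverses the sign of the
  determinant.\<close>

lemma normal_frame_exists:
  assumes tan: "minkowski (partial_u z p) (partial_u z p) > 0" "minkowski (partial_v z p) (partial_v z p) > 0"
      "minkowski (partial_u z p) (partial_v z p) = 0"
    and nor: "minkowski (partial_u z p) n1 = 0" "minkowski (partial_v z p) n1 = 0"
      "minkowski (partial_u z p) n2 = 0" "minkowski (partial_v z p) n2 = 0"
      "minkowski n1 n2 = 0" "minkowski n1 n1 = 1" "minkowski n2 n2 = -1"
  shows "\<exists>n. normal_frame z p n"
proof -
  let ?A = "\<lambda>n1. vector [partial_u z p, partial_v z p, n1, n2] :: real^4^4"
  have "\<forall>i j. i \<noteq> j \<longrightarrow> minkowski (?A n1 $ i) (?A n1 $ j) = 0"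
    unfolding forall_4 vector_4
    by (simp add: tan nor minkowski_commute[of n1 "partial_u z p"] minkowski_commute[of n1 "partial_v z p"]
        minkowski_commute[of n2 "partial_u z p"] minkowski_commute[of n2 "partial_v z p"]
        minkowski_commute[of n2 n1] minkowski_commute[of "partial_v z p" "partial_u z p"])
  then have "minkowski (?A n1 $ i) (?A n1 $ j) = 0" if "i \<noteq> j" for i j
    using that by blast
  from det_minkowski_orthogonal_rows[of "?A n1", OF this]
  have "(det (?A n1))\<^sup>2 > 0"
    using tan nor by (simp add: prod_4)
  then have "det (?A n1) \<noteq> 0"
    by auto
  moreover have "det (?A (- n1)) = - det (?A n1)"
  proof -
    have "?A (- n1) = (\<chi> i. if i = 3 then (-1) *s n1 else ?A n1 $ i)"
      "?A n1 = (\<chi> i. if i = 3 then n1 else ?A n1 $ i)"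
      by (simp_all add: vec_eq_iff forall_4)
    then show ?thesis
      using det_row_mul[of 3 "-1" "\<lambda>_. n1" "\<lambda>i. ?A n1 $ i"] by simp
  qed
  ultimately have "det (?A n1) > 0 \<or> det (?A (- n1)) > 0"
    by linarith
  then have "normal_frame z p (n1, n2) \<or> normal_frame z p (- n1, n2)"
    using nor by (auto simp: normal_frame_def minkowski_commute)
  then show ?thesis
    by blast
qed

text \<open>
  Both types at once: \<open>C, S\<close> are \<open>cosh, sinh\<close> of \<open>\<beta> v\<close> with \<open>\<sigma> = 1\<close> for the first type, and
  \<open>sinh, cosh\<close> with \<open>\<sigma> = -1\<close> for the second.
\<close>

locale rotational_surface =
  fixes \<alpha> \<beta> \<sigma> :: real and C S f g :: "real \<Rightarrow> real" and J :: "real set" and z :: surface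
  assumes pos: "\<alpha> > 0" "\<beta> > 0"
    and J: "open J" "is_interval J" "J \<noteq> {}"
    and smooth: "smooth_on f J" "smooth_on g J"
    and hyp_deriv: "\<And>v. (C has_real_derivative \<beta> * S v) (at v)" "\<And>v. (S has_real_derivative \<beta> * C v) (at v)"
    and hyp_id: "\<And>v. (C v)\<^sup>2 - (S v)\<^sup>2 = \<sigma>"
    and sign: "\<sigma> = 1 \<or> \<sigma> = -1"
    and E_pos: "\<And>u. u \<in> J \<Longrightarrow> (deriv f u)\<^sup>2 + \<sigma> * (deriv g u)\<^sup>2 > 0"
    and G_pos: "\<And>u. u \<in> J \<Longrightarrow> \<alpha>\<^sup>2 * (f u)\<^sup>2 - \<sigma> * (\<beta>\<^sup>2 * (g u)\<^sup>2) > 0"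
    and z_eq: "z = (\<lambda>(u, v). vector [f u * cos (\<alpha> * v), f u * sin (\<alpha> * v), g u * C v, g u * S v])"
begin

section \<open>Calculus in the moving frame\<close>

abbreviation "f' \<equiv> deriv f"
abbreviation "g' \<equiv> deriv g"
abbreviation "f'' \<equiv> deriv (deriv f)"
abbreviation "g'' \<equiv> deriv (deriv g)"

text \<open>
  The image under the isometry with parameter \<open>v\<close> of the vector with coordinates \<open>(a, b, p, q)\<close>;
  for the second type (\<open>\<sigma> = -1\<close>) the last two coordinates are swapped, so that \<open>q\<close> belongs to the
  spacelike direction.
\<close>

definition screw :: "real \<Rightarrow> real \<Rightarrow> real \<Rightarrow> real \<Rightarrow> real \<Rightarrow> real^4" where
  "screw v a b p q = vector [a * cos (\<alpha> * v) - b * sin (\<alpha> * v), a * sin (\<alpha> * v) + b * cos (\<alpha> * v),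
     p * C v + q * S v, p * S v + q * C v]"

lemma sigma_square: "\<sigma> * \<sigma> = 1" and sigma_nonzero: "\<sigma> \<noteq> 0"
  using sign by auto

text \<open>The point is that \<open>v\<close> drops out: the frame at \<open>v\<close> consists of
  a rotated pair and a hyperbolically rotated pair, whose products are fixed by
  \<open>hyp_id\<close>.\<close>

lemma minkowski_screw:
  "minkowski (screw v a b p q) (screw v a1 b1 p1 q1) = a * a1 + b * b1 + \<sigma> * (p * p1 - q * q1)"
proof -
  have "minkowski (screw v a b p q) (screw v a1 b1 p1 q1) =
      (a * a1 + b * b1) * ((cos (\<alpha> * v))\<^sup>2 + (sin (\<alpha> * v))\<^sup>2) + ((C v)\<^sup>2 - (S v)\<^sup>2) * (p * p1 - q * q1)"
    by (simp only: minkowski_def screw_def vector_4) algebra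
  then show ?thesis
    by (simp add: hyp_id)
qed

lemma screw_surj: "\<exists>a b p q. m = screw v a b p q"
proof -
  let ?c = "cos (\<alpha> * v)" and ?s = "sin (\<alpha> * v)"
  \<comment> \<open>The coordinates come from inverting the rotation and the matrix with rows
    \<open>(C, S)\<close> and \<open>(S, C)\<close>, whose determinant is \<sigma>, its own
    inverse.\<close>
  have 1: "x = (x * ?c + y * ?s) * ?c - (y * ?c - x * ?s) * ?s"
    "y = (x * ?c + y * ?s) * ?s + (y * ?c - x * ?s) * ?c" for x y
    using sin_cos_squared_add[of "\<alpha> * v"] by algebra+
  have "1 = \<sigma> * ((C v)\<^sup>2 - (S v)\<^sup>2)"
    by (simp add: hyp_id sigma_square)
  then have 2: "x = (\<sigma> * (x * C v - y * S v)) * C v + (\<sigma> * (y * C v - x * S v)) * S v"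
    "y = (\<sigma> * (x * C v - y * S v)) * S v + (\<sigma> * (y * C v - x * S v)) * C v" for x y
    by algebra+
  have "m = screw v (m $ 1 * ?c + m $ 2 * ?s) (m $ 2 * ?c - m $ 1 * ?s)
      (\<sigma> * (m $ 3 * C v - m $ 4 * S v)) (\<sigma> * (m $ 4 * C v - m $ 3 * S v))"
    unfolding vec_eq_iff forall_4 screw_def vector_4
    using 1(1)[of "m $ 1" "m $ 2"] 1(2)[of "m $ 2" "m $ 1"]
      2(1)[of "m $ 3" "m $ 4"] 2(2)[of "m $ 4" "m $ 3"] by blast
  then show ?thesis
    by blast
qed

text \<open>Differentiating the frame rotates \<open>(a, b)\<close> at rate \<alpha> and mixes
  \<open>(p, q)\<close> at rate \<beta>, so derivatives can again be read in the frame at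
  \<open>w t\<close>.\<close>

lemma screw_has_vector_derivative:
  assumes "(a has_real_derivative a') (at t within I)" "(b has_real_derivative b') (at t within I)"
    "(p has_real_derivative p') (at t within I)" "(q has_real_derivative q') (at t within I)"
    and v: "(w has_real_derivative w') (at t within I)"
  shows "((\<lambda>t. screw (w t) (a t) (b t) (p t) (q t)) has_vector_derivative
      screw (w t) (a' - \<alpha> * b t * w') (b' + \<alpha> * a t * w') (p' + \<beta> * q t * w') (q' + \<beta> * p t * w'))
      (at t within I)"
proof -
  note hyp = DERIV_chain2[OF hyp_deriv(1) v] DERIV_chain2[OF hyp_deriv(2) v]
  show ?thesis
    unfolding screw_def
    by (rule has_vector_derivative_vec4; simp only: vector_4)
      (auto intro!: derivative_eq_intros assms hyp simp: algebra_simps)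
qed

lemma z_screw: "z (u, v) = screw v (f u) 0 (g u) 0"
  by (simp add: z_eq screw_def)

lemma deriv_f: "u \<in> J \<Longrightarrow> (f has_real_derivative f' u) (at u)"
  and deriv_g: "u \<in> J \<Longrightarrow> (g has_real_derivative g' u) (at u)"
  and deriv_f': "u \<in> J \<Longrightarrow> (f' has_real_derivative f'' u) (at u)"
  and deriv_g': "u \<in> J \<Longrightarrow> (g' has_real_derivative g'' u) (at u)"
  and cont_f'': "u \<in> J \<Longrightarrow> isCont f'' u"
  and cont_g'': "u \<in> J \<Longrightarrow> isCont g'' u"
proof -
  note s = smooth[unfolded smooth_on_def, rule_format]
  show "u \<in> J \<Longrightarrow> (f has_real_derivative f' u) (at u)"
    "u \<in> J \<Longrightarrow> (g has_real_derivative g' u) (at u)"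
    using s[of u 0] by (simp_all add: DERIV_deriv_iff_real_differentiable)
  show "u \<in> J \<Longrightarrow> (f' has_real_derivative f'' u) (at u)"
    "u \<in> J \<Longrightarrow> (g' has_real_derivative g'' u) (at u)"
    using s[of u 1] by (simp_all add: DERIV_deriv_iff_real_differentiable)
  show "u \<in> J \<Longrightarrow> isCont f'' u" "u \<in> J \<Longrightarrow> isCont g'' u"
    using s[of u 2] by (simp_all add: numeral_2_eq_2 differentiable_imp_continuous_within)
qed

lemma partials:
  assumes u: "u \<in> J"
  shows "partial_u z (u, v) = screw v (f' u) 0 (g' u) 0"
    and "partial_v z (u, v) = screw v 0 (\<alpha> * f u) 0 (\<beta> * g u)"
    and "partial_u (partial_u z) (u, v) = screw v (f'' u) 0 (g'' u) 0"
    and "partial_v (partial_u z) (u, v) = screw v 0 (\<alpha> * f' u) 0 (\<beta> * g' u)"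
    and "partial_v (partial_v z) (u, v) = screw v (- \<alpha>\<^sup>2 * f u) 0 (\<beta>\<^sup>2 * g u) 0"
proof -
  have zu: "partial_u z (u, v) = screw v (f' u) 0 (g' u) 0" if "u \<in> J" for u v
    unfolding partial_u_def z_screw fst_conv snd_conv
    by (rule vector_derivative_at)
      (use screw_has_vector_derivative[OF deriv_f[OF that] DERIV_const[of 0] deriv_g[OF that]
          DERIV_const[of 0] DERIV_const[of v]] in simp)
  have zv: "partial_v z (u, v) = screw v 0 (\<alpha> * f u) 0 (\<beta> * g u)" for u v
    unfolding partial_v_def z_screw fst_conv snd_conv
    by (rule vector_derivative_at)
      (use screw_has_vector_derivative[OF DERIV_const[of "f u"] DERIV_const[of 0] DERIV_const[of "g u"]
          DERIV_const[of 0] DERIV_ident[of "at v"]] in simp)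
  show "partial_u z (u, v) = screw v (f' u) 0 (g' u) 0"
    by (fact zu[OF u])
  show "partial_v z (u, v) = screw v 0 (\<alpha> * f u) 0 (\<beta> * g u)"
    by (fact zv)
  show "partial_u (partial_u z) (u, v) = screw v (f'' u) 0 (g'' u) 0"
    unfolding partial_u_def[of "partial_u z"] fst_conv snd_conv
  proof (rule vector_derivative_at)
    show "((\<lambda>s. partial_u z (s, v)) has_vector_derivative screw v (f'' u) 0 (g'' u) 0) (at u)"
      \<comment> \<open>The formula for \<open>partial_u z\<close> is known only over
        \<open>J\<close>; openness makes it valid near \<open>u\<close>, which is enough to
        differentiate it.\<close>
      by (rule has_vector_derivative_transform_within_open[OF _ J(1) u zu[symmetric]])
        (use screw_has_vector_derivative[OF deriv_f'[OF u] DERIV_const[of 0] deriv_g'[OF u]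
            DERIV_const[of 0] DERIV_const[of v]] in simp)
  qed
  show "partial_v (partial_u z) (u, v) = screw v 0 (\<alpha> * f' u) 0 (\<beta> * g' u)"
    unfolding partial_v_def zu[OF u] fst_conv snd_conv
    by (rule vector_derivative_at)
      (use screw_has_vector_derivative[OF DERIV_const[of "f' u"] DERIV_const[of 0] DERIV_const[of "g' u"]
          DERIV_const[of 0] DERIV_ident[of "at v"]] in simp)
  show "partial_v (partial_v z) (u, v) = screw v (- \<alpha>\<^sup>2 * f u) 0 (\<beta>\<^sup>2 * g u) 0"
    unfolding partial_v_def[of "partial_v z"] zv fst_conv snd_conv
    by (rule vector_derivative_at)
      (use screw_has_vector_derivative[OF DERIV_const[of 0] DERIV_const[of "\<alpha> * f u"] DERIV_const[of 0]
          DERIV_const[of "\<beta> * g u"] DERIV_ident[of "at v"]] in \<open>simp add: power2_eq_square mult.assoc\<close>)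
qed

section \<open>Fundamental forms and the zeros of the invariant k\<close>

definition merid_curv :: "real \<Rightarrow> real" where
  "merid_curv u = f' u * g'' u - f'' u * g' u"

text \<open>This is Q, the determinant of velocity and position of the meridian; it vanishes where
  the tangent line passes through the origin.\<close>

definition radial_det :: "real \<Rightarrow> real" where
  "radial_det u = f' u * g u - f u * g' u"

text \<open>This is R; where \<open>f\<close> is nonzero it is, up to a nonvanishing factor, the
  derivative of g |f|^(\<beta>^2/\<alpha>^2).\<close>

definition power_defect :: "real \<Rightarrow> real" where
  "power_defect u = \<alpha>\<^sup>2 * (f u * g' u) + \<beta>\<^sup>2 * (g u * f' u)"

definition E_val :: "real \<Rightarrow> real" where
  "E_val u = (f' u)\<^sup>2 + \<sigma> * (g' u)\<^sup>2"

definition G_val :: "real \<Rightarrow> real" where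
  "G_val u = \<alpha>\<^sup>2 * (f u)\<^sup>2 - \<sigma> * (\<beta>\<^sup>2 * (g u)\<^sup>2)"

lemma E_val_pos: "u \<in> J \<Longrightarrow> E_val u > 0" and G_val_pos: "u \<in> J \<Longrightarrow> G_val u > 0"
  using E_pos G_pos by (simp_all add: E_val_def G_val_def)

lemma first_form:
  assumes "u \<in> J"
  shows "E_coeff z (u, v) = E_val u" "F_coeff z (u, v) = 0" "G_coeff z (u, v) = G_val u"
  by (simp_all add: E_coeff_def F_coeff_def G_coeff_def partials[OF assms] minkowski_screw
      E_val_def G_val_def algebra_simps power2_eq_square)

text \<open>The normals stay unnormalised, so that their coordinates are polynomial in the data. For
  \<sigma> = 1 this one is spacelike and \<open>normal2\<close> timelike; for \<sigma> = -1 the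
  roles are exchanged.\<close>

definition normal1 :: "real \<Rightarrow> real \<Rightarrow> real^4" where
  "normal1 u v = screw v (g' u) 0 (- \<sigma> * f' u) 0"

definition normal2 :: "real \<Rightarrow> real \<Rightarrow> real^4" where
  "normal2 u v = screw v 0 (\<beta> * g u) 0 (\<sigma> * (\<alpha> * f u))"

lemma sigma_cancel: "\<sigma> * (\<sigma> * x) = x"
  using sigma_square by (metis mult.assoc mult_1)

lemma normals:
  assumes "u \<in> J"
  shows "minkowski (partial_u z (u, v)) (normal1 u v) = 0" "minkowski (partial_v z (u, v)) (normal1 u v) = 0"
    "minkowski (partial_u z (u, v)) (normal2 u v) = 0" "minkowski (partial_v z (u, v)) (normal2 u v) = 0"
    "minkowski (normal1 u v) (normal2 u v) = 0"
    "minkowski (normal1 u v) (normal1 u v) = \<sigma> * E_val u"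
    "minkowski (normal2 u v) (normal2 u v) = - \<sigma> * G_val u"
  by (simp_all add: normal1_def normal2_def partials[OF assms] minkowski_screw E_val_def G_val_def
      algebra_simps power2_eq_square sigma_cancel)

lemma normal_frame_at:
  assumes u: "u \<in> J"
  shows "\<exists>n. normal_frame z (u, v) n"
proof -
  define n1 where "n1 = (1 / sqrt (E_val u)) *\<^sub>R normal1 u v"
  define n2 where "n2 = (1 / sqrt (G_val u)) *\<^sub>R normal2 u v"
  note EG = E_val_pos[OF u] G_val_pos[OF u]
  have nn: "minkowski n1 n1 = \<sigma>" "minkowski n2 n2 = - \<sigma>"
    using EG by (simp_all add: n1_def n2_def normals[OF u])
  have orth: "minkowski (partial_u z (u, v)) n1 = 0" "minkowski (partial_v z (u, v)) n1 = 0"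
    "minkowski (partial_u z (u, v)) n2 = 0" "minkowski (partial_v z (u, v)) n2 = 0"
    "minkowski n1 n2 = 0" "minkowski n2 n1 = 0"
    by (simp_all add: n1_def n2_def normals[OF u] minkowski_commute[of "normal2 u v" "normal1 u v"])
  have tan: "minkowski (partial_u z (u, v)) (partial_u z (u, v)) > 0"
    "minkowski (partial_v z (u, v)) (partial_v z (u, v)) > 0"
    "minkowski (partial_u z (u, v)) (partial_v z (u, v)) = 0"
    using first_form[OF u, of v] EG by (simp_all add: E_coeff_def F_coeff_def G_coeff_def)
  show ?thesis
    using sign
  proof
    assume "\<sigma> = 1"
    then show ?thesis
      using normal_frame_exists[OF tan orth(1-5)] nn by simp
  next
    \<comment> \<open>Now \<open>n2\<close> is the spacelike unit normal, so the two normals enter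
      in exchanged order.\<close>
    assume "\<sigma> = -1"
    then show ?thesis
      using normal_frame_exists[OF tan orth(3,4,1,2,6)] nn by simp
  qed
qed

text \<open>Orthogonality to \<open>partial_u z\<close> confines the first and third moving
  coordinates to a line, orthogonality to \<open>partial_v z\<close> the other two.\<close>

lemma normal_combination:
  assumes u: "u \<in> J" and n: "minkowski (partial_u z (u, v)) m = 0" "minkowski (partial_v z (u, v)) m = 0"
  shows "\<exists>a b. m = a *\<^sub>R normal1 u v + b *\<^sub>R normal2 u v"
proof -
  obtain p q r t where m: "m = screw v p q r t"
    using screw_surj by blast
  have h: "p * f' u + \<sigma> * (r * g' u) = 0" "q * (\<alpha> * f u) - \<sigma> * (t * (\<beta> * g u)) = 0"
    using n by (simp_all add: m partials[OF u] minkowski_screw algebra_simps)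
  \<comment> \<open>Both coefficients are Minkowski projections: the product of \<open>m\<close>
    with the normal, divided by the square of that normal.\<close>
  define a where "a = \<sigma> * (p * g' u - r * f' u) / E_val u"
  define b where "b = \<sigma> * (t * (\<alpha> * f u) - q * (\<beta> * g u)) / G_val u"
  have "E_val u * p = \<sigma> * (p * g' u - r * f' u) * g' u"
    "E_val u * r = \<sigma> * (p * g' u - r * f' u) * (- \<sigma> * f' u)"
    "G_val u * q = \<sigma> * (t * (\<alpha> * f u) - q * (\<beta> * g u)) * (\<beta> * g u)"
    "G_val u * t = \<sigma> * (t * (\<alpha> * f u) - q * (\<beta> * g u)) * (\<sigma> * (\<alpha> * f u))"
    using h sigma_square unfolding E_val_def G_val_def by algebra+
  then have "p = a * g' u" "r = a * (- \<sigma> * f' u)" "q = b * (\<beta> * g u)" "t = b * (\<sigma> * (\<alpha> * f u))"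
    using E_val_pos[OF u] G_val_pos[OF u] unfolding a_def b_def by (simp_all add: field_simps)
  then have "m = a *\<^sub>R normal1 u v + b *\<^sub>R normal2 u v"
    by (simp add: m normal1_def normal2_def screw_def vec_eq_iff forall_4 algebra_simps)
  then show ?thesis
    by blast
qed

text \<open>The vectors z_uu, z_vv and \<open>normal1\<close> have only first and third moving
  coordinates, while z_uv and \<open>normal2\<close> have only the second and fourth; hence each
  entry sees a single normal component.\<close>

lemma second_form:
  assumes u: "u \<in> J"
  shows "c11 z (u, v) (a *\<^sub>R normal1 u v + b *\<^sub>R normal2 u v) = - a * merid_curv u"
    "c12 z (u, v) (a *\<^sub>R normal1 u v + b *\<^sub>R normal2 u v) = b * (\<alpha> * \<beta> * radial_det u)"
    "c22 z (u, v) (a *\<^sub>R normal1 u v + b *\<^sub>R normal2 u v) = - a * power_defect u"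
  by (simp_all add: c11_def c12_def c22_def partials[OF u] minkowski_add normal1_def normal2_def
      minkowski_screw merid_curv_def radial_det_def power_defect_def algebra_simps power2_eq_square sigma_cancel)

text \<open>Changing from \<open>normal1\<close>, \<open>normal2\<close> to an arbitrary frame
  multiplies L and N by the determinant \<delta> of the change and leaves M = 0, so k is a nonzero
  multiple of P Q^2 R.\<close>

lemma k_in_frame_eq_0_iff:
  assumes u: "u \<in> J" and fr: "normal_frame z (u, v) (m1, m2)"
  shows "k_in_frame z (u, v) (m1, m2) = 0 \<longleftrightarrow> merid_curv u * radial_det u * power_defect u = 0"
proof -
  from fr have orth: "minkowski (partial_u z (u, v)) m1 = 0" "minkowski (partial_v z (u, v)) m1 = 0"
    "minkowski (partial_u z (u, v)) m2 = 0" "minkowski (partial_v z (u, v)) m2 = 0"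
    and mm: "minkowski m1 m1 = 1" "minkowski m2 m2 = -1" "minkowski m1 m2 = 0"
    by (auto simp: normal_frame_def)
  obtain a1 b1 where m1: "m1 = a1 *\<^sub>R normal1 u v + b1 *\<^sub>R normal2 u v"
    using normal_combination[OF u orth(1,2)] by blast
  obtain a2 b2 where m2: "m2 = a2 *\<^sub>R normal1 u v + b2 *\<^sub>R normal2 u v"
    using normal_combination[OF u orth(3,4)] by blast
  define \<delta> where "\<delta> = a1 * b2 - a2 * b1"
  have "a1 * a1 * (\<sigma> * E_val u) - b1 * b1 * (\<sigma> * G_val u) = 1"
    "a2 * a2 * (\<sigma> * E_val u) - b2 * b2 * (\<sigma> * G_val u) = -1"
    "a1 * a2 * (\<sigma> * E_val u) - b1 * b2 * (\<sigma> * G_val u) = 0"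
    using mm by (simp_all add: m1 m2 minkowski_add normals[OF u]
        minkowski_commute[of "normal2 u v" "normal1 u v"] algebra_simps)
  \<comment> \<open>Comparison of the Gram determinants of the two normal bases, one of which is
    -1.\<close>
  then have "(\<sigma> * E_val u) * (\<sigma> * G_val u) * \<delta>\<^sup>2 = 1"
    unfolding \<delta>_def by algebra
  then have \<delta>: "\<delta> \<noteq> 0"
    by auto
  note EG = E_val_pos[OF u] G_val_pos[OF u]
  have W: "W_coeff z (u, v) = sqrt (E_val u * G_val u)" "E_val u * G_val u > 0"
    using EG by (simp_all add: W_coeff_def first_form[OF u])
  then have W0: "W_coeff z (u, v) \<noteq> 0"
    by (metis less_numeral_extra(3) real_sqrt_gt_0_iff)
  have "L_coeff z (u, v) m1 m2 = 2 / W_coeff z (u, v) * (- \<alpha> * \<beta> * \<delta> * merid_curv u * radial_det u)"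
    unfolding L_coeff_def m1 m2 second_form[OF u] \<delta>_def by (simp add: algebra_simps)
  moreover have "N_coeff z (u, v) m1 m2 = 2 / W_coeff z (u, v) * (\<alpha> * \<beta> * \<delta> * radial_det u * power_defect u)"
    unfolding N_coeff_def m1 m2 second_form[OF u] \<delta>_def by (simp add: algebra_simps)
  moreover have "M_coeff z (u, v) m1 m2 = 0"
    unfolding M_coeff_def m1 m2 second_form[OF u] by simp
  ultimately show ?thesis
    using W0 W(2) \<delta> pos by (auto simp: k_in_frame_def first_form[OF u])
qed

lemma parabolic_point_iff:
  assumes u: "u \<in> J"
  shows "parabolic_point z (u, v) \<longleftrightarrow> merid_curv u * radial_det u * power_defect u = 0"
proof -
  have "normal_frame z (u, v) (SOME n. normal_frame z (u, v) n)"
    using normal_frame_at[OF u] by (rule someI_ex)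
  then show ?thesis
    unfolding parabolic_point_def k_invariant_def
    by (metis k_in_frame_eq_0_iff[OF u] surj_pair)
qed

section \<open>Rulings force P Q R = 0\<close>

text \<open>
  Differentiates along the ruling the product of its tangent with a fixed normal; as \<open>X\<close> is merely
  continuous, the derivative at \<open>t0\<close> is taken as a limit of difference quotients.
\<close>

lemma parabolic_on_line:
  assumes I: "is_interval I" "interior I \<noteq> {}" "t0 \<in> I"
    and \<gamma>: "\<And>t. t \<in> I \<Longrightarrow> (\<gamma> has_vector_derivative X (\<gamma> t)) (at t within I)"
    and sub: "\<And>t. t \<in> I \<Longrightarrow> fst (\<gamma> t) \<in> J"
    and X: "continuous_on (\<gamma> ` I) X" "X (\<gamma> t0) \<noteq> 0"
    and line: "collinear (z ` \<gamma> ` I)"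
  shows "merid_curv (fst (\<gamma> t0)) * radial_det (fst (\<gamma> t0)) * power_defect (fst (\<gamma> t0)) = 0"
proof -
  define u where "u = (\<lambda>t. fst (\<gamma> t))"
  define v where "v = (\<lambda>t. snd (\<gamma> t))"
  define U where "U = (\<lambda>t. fst (X (\<gamma> t)))"
  define V where "V = (\<lambda>t. snd (X (\<gamma> t)))"
  have uJ: "u t \<in> J" if "t \<in> I" for t
    using sub[OF that] by (simp add: u_def)
  have du: "(u has_real_derivative U t) (at t within I)"
    and dv: "(v has_real_derivative V t) (at t within I)" if "t \<in> I" for t
    using bounded_linear.has_vector_derivative[OF bounded_linear_fst \<gamma>[OF that]]
      bounded_linear.has_vector_derivative[OF bounded_linear_snd \<gamma>[OF that]]
    by (simp_all add: u_def v_def U_def V_def has_real_derivative_iff_has_vector_derivative)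
  have "continuous_on I \<gamma>"
    using \<gamma> by (meson continuous_on_eq_continuous_within has_vector_derivative_continuous)
  then have "continuous_on I (\<lambda>t. X (\<gamma> t))"
    by (rule continuous_on_compose2[OF X(1)]) simp
  then have lim: "(U \<longlongrightarrow> U t0) (at t0 within I)" "(V \<longlongrightarrow> V t0) (at t0 within I)"
    unfolding U_def V_def using I(3) by (auto intro!: tendsto_fst tendsto_snd simp: continuous_on)
  \<comment> \<open>An interval with interior has no isolated point, so one-sided derivatives at an
    end of the leaf are still unique.\<close>
  have ntriv: "at t within I \<noteq> bot" if "t \<in> I" for t
  proof -
    have "connected I" "I \<noteq> {t}"
      using I(1,2) is_interval_connected by auto
    then show ?thesis
      using connected_imp_perfect[of I t] that by (auto simp: trivial_limit_within)
  qed
  define w where "w = (\<lambda>t. screw (v t) (f' (u t) * U t) (\<alpha> * f (u t) * V t) (g' (u t) * U t) (\<beta> * g (u t) * V t))"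
  have dz: "((\<lambda>t. z (\<gamma> t)) has_vector_derivative w t) (at t within I)" if "t \<in> I" for t
  proof -
    have "(\<lambda>t. z (\<gamma> t)) = (\<lambda>t. screw (v t) (f (u t)) 0 (g (u t)) 0)"
      by (simp add: u_def v_def flip: z_screw)
    then show ?thesis
      using screw_has_vector_derivative[OF DERIV_chain2[OF deriv_f[OF uJ[OF that]] du[OF that]] DERIV_const[of 0]
          DERIV_chain2[OF deriv_g[OF uJ[OF that]] du[OF that]] DERIV_const[of 0] dv[OF that]]
      by (simp add: w_def)
  qed
  have dzn: "((\<lambda>t. minkowski (z (\<gamma> t)) n) has_vector_derivative minkowski (w t) n) (at t within I)"
    if "t \<in> I" for t n
    by (rule bounded_linear.has_vector_derivative[OF bounded_linear_minkowski dz[OF that]])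
  have "minkowski (w t0) (w t0) = E_val (u t0) * (U t0)\<^sup>2 + G_val (u t0) * (V t0)\<^sup>2"
    by (simp add: w_def minkowski_screw E_val_def G_val_def algebra_simps power2_eq_square)
  moreover have "U t0 \<noteq> 0 \<or> V t0 \<noteq> 0"
    using X(2) by (auto simp: U_def V_def prod_eq_iff)
  then have "E_val (u t0) * (U t0)\<^sup>2 + G_val (u t0) * (V t0)\<^sup>2 > 0"
    using E_val_pos[OF uJ[OF I(3)]] G_val_pos[OF uJ[OF I(3)]]
    by (auto intro: add_pos_nonneg add_nonneg_pos)
  ultimately have w0: "w t0 \<noteq> 0"
    by (auto simp: minkowski_def)
  obtain b where b: "\<And>t. t \<in> I \<Longrightarrow> \<exists>c. z (\<gamma> t) - z (\<gamma> t0) = c *\<^sub>R b"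
    using line I(3) unfolding collinear_def by blast
  \<comment> \<open>The displacement \<open>?\<Delta> t\<close> is parallel to \<open>b\<close>, so
    the antisymmetric expression in \<open>d0\<close> vanishes identically. Its derivative at
    \<open>t0\<close> gives \<open>minkowski b n = 0\<close> because \<open>w t0\<close> is nonzero;
    hence \<open>n\<close> annihilates the whole line. No smooth dependence of the multiple of
    \<open>b\<close> on \<open>t\<close> has to be known.\<close>
  have tangent_orth: "minkowski (w t) n = 0" if n: "minkowski (w t0) n = 0" and t: "t \<in> I" for n t
  proof -
    let ?\<Delta> = "\<lambda>t. z (\<gamma> t) - z (\<gamma> t0)"
    have d0: "((\<lambda>t. minkowski (?\<Delta> t) n *\<^sub>R b - minkowski b n *\<^sub>R ?\<Delta> t) has_vector_derivative
        minkowski (w t0) n *\<^sub>R b - minkowski b n *\<^sub>R w t0) (at t0 within I)"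
    proof -
      have d: "(?\<Delta> has_vector_derivative w t0) (at t0 within I)"
        using has_vector_derivative_diff[OF dz[OF I(3)] has_vector_derivative_const] by simp
      have "bounded_linear (\<lambda>x. minkowski x n *\<^sub>R b - minkowski b n *\<^sub>R x)"
        by (intro bounded_linear_sub bounded_linear_scaleR_right bounded_linear_minkowski
            bounded_linear_compose[OF bounded_linear_scaleR_left])
      from bounded_linear.has_vector_derivative[OF this d] show ?thesis .
    qed
    have zero: "0 = minkowski (?\<Delta> t) n *\<^sub>R b - minkowski b n *\<^sub>R ?\<Delta> t" if "t \<in> I" for t
      using b[OF that] by auto
    have "minkowski (w t0) n *\<^sub>R b - minkowski b n *\<^sub>R w t0 = 0"
      using has_vector_derivative_transform[OF I(3) zero d0]
        vector_derivative_unique_within[OF ntriv[OF I(3)] _ has_vector_derivative_const] by blast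
    then have "minkowski b n = 0"
      using n w0 by simp
    then have const: "minkowski (z (\<gamma> s)) n = minkowski (z (\<gamma> t0)) n" if s: "s \<in> I" for s
    proof -
      obtain c where "z (\<gamma> s) - z (\<gamma> t0) = c *\<^sub>R b"
        using b[OF s] by blast
      then have "z (\<gamma> s) = z (\<gamma> t0) + c *\<^sub>R b"
        by (simp add: diff_eq_eq add.commute)
      then show ?thesis
        using \<open>minkowski b n = 0\<close> by (simp add: minkowski_add)
    qed
    have "((\<lambda>t. minkowski (z (\<gamma> t0)) n) has_vector_derivative minkowski (w t) n) (at t within I)"
      by (rule has_vector_derivative_transform[OF t _ dzn[OF t]]) (simp add: const)
    then show ?thesis
      using vector_derivative_unique_within[OF ntriv[OF t] _ has_vector_derivative_const] by blast
  qed
  \<comment> \<open>Products of z_u and z_v along the leaf with a fixed vector \<open>n\<close>;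
    \<open>p'\<close> and \<open>q'\<close> are their derivatives at \<open>t0\<close>.\<close>
  define p where "p = (\<lambda>n t. minkowski (screw (v t) (f' (u t)) 0 (g' (u t)) 0) n)"
  define q where "q = (\<lambda>n t. minkowski (screw (v t) 0 (\<alpha> * f (u t)) 0 (\<beta> * g (u t))) n)"
  define p' where "p' = (\<lambda>n. minkowski (screw (v t0) (f'' (u t0) * U t0) (\<alpha> * f' (u t0) * V t0)
      (g'' (u t0) * U t0) (\<beta> * g' (u t0) * V t0)) n)"
  define q' where "q' = (\<lambda>n. minkowski (screw (v t0) (- \<alpha>\<^sup>2 * f (u t0) * V t0) (\<alpha> * f' (u t0) * U t0)
      (\<beta>\<^sup>2 * g (u t0) * V t0) (\<beta> * g' (u t0) * U t0)) n)"
  note u0 = uJ[OF I(3)] and du0 = du[OF I(3)] and dv0 = dv[OF I(3)]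
  have dp: "(p n has_real_derivative p' n) (at t0 within I)" for n
    unfolding p_def p'_def has_real_derivative_iff_has_vector_derivative
    by (rule bounded_linear.has_vector_derivative[OF bounded_linear_minkowski])
      (use screw_has_vector_derivative[OF DERIV_chain2[OF deriv_f'[OF u0] du0] DERIV_const[of 0]
          DERIV_chain2[OF deriv_g'[OF u0] du0] DERIV_const[of 0] dv0] in simp)
  have dq: "(q n has_real_derivative q' n) (at t0 within I)" for n
    unfolding q_def q'_def has_real_derivative_iff_has_vector_derivative
    by (rule bounded_linear.has_vector_derivative[OF bounded_linear_minkowski])
      (use screw_has_vector_derivative[OF DERIV_const[of 0] DERIV_cmult[OF DERIV_chain2[OF deriv_f[OF u0] du0], of \<alpha>]
          DERIV_const[of 0] DERIV_cmult[OF DERIV_chain2[OF deriv_g[OF u0] du0], of \<beta>] dv0]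
        in \<open>simp add: power2_eq_square mult.assoc\<close>)
  have second: "U t0 * p' n + V t0 * q' n = 0" if n: "p n t0 = 0" "q n t0 = 0" for n
  proof -
    have w_n: "minkowski (w t) n = U t * p n t + V t * q n t" for t
    proof -
      have "w t = U t *\<^sub>R screw (v t) (f' (u t)) 0 (g' (u t)) 0 + V t *\<^sub>R screw (v t) 0 (\<alpha> * f (u t)) 0 (\<beta> * g (u t))"
        by (simp add: w_def screw_def vec_eq_iff forall_4 algebra_simps)
      then show ?thesis
        by (simp add: p_def q_def minkowski_add)
    qed
    have zero: "U t * p n t + V t * q n t = 0" if "t \<in> I" for t
      using tangent_orth[OF _ that, of n] n by (simp add: w_n)
    have "((\<lambda>t. U t * ((p n t - p n t0) / (t - t0)) + V t * ((q n t - q n t0) / (t - t0)))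
        \<longlongrightarrow> U t0 * p' n + V t0 * q' n) (at t0 within I)"
      using dp[of n] dq[of n] unfolding has_field_derivative_iff by (intro tendsto_intros lim)
    \<comment> \<open>Since \<open>p n t0\<close> and \<open>q n t0\<close> vanish, this is the
      identity \<open>zero\<close> divided by \<open>t - t0\<close>; only continuity of
      \<open>U\<close> and \<open>V\<close> enters the limit.\<close>
    moreover have "U t * ((p n t - p n t0) / (t - t0)) + V t * ((q n t - q n t0) / (t - t0)) = 0" if "t \<in> I" for t
      using zero[OF that] n by (simp flip: add_divide_distrib)
    then have "((\<lambda>t. U t * ((p n t - p n t0) / (t - t0)) + V t * ((q n t - q n t0) / (t - t0)))
        \<longlongrightarrow> 0) (at t0 within I)"
      by (intro tendsto_eventually) (simp add: eventually_at_filter)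
    ultimately show ?thesis
      using tendsto_unique[OF ntriv[OF I(3)]] by blast
  qed
  have "U t0 * p' (normal1 (u t0) (v t0)) + V t0 * q' (normal1 (u t0) (v t0)) = 0"
    by (rule second) (use normals[OF u0, of "v t0"] in \<open>simp_all add: p_def q_def partials[OF u0]\<close>)
  then have h1: "merid_curv (u t0) * (U t0)\<^sup>2 + power_defect (u t0) * (V t0)\<^sup>2 = 0"
    by (simp add: p'_def q'_def normal1_def minkowski_screw merid_curv_def power_defect_def
        algebra_simps power2_eq_square sigma_cancel)
  have "U t0 * p' (normal2 (u t0) (v t0)) + V t0 * q' (normal2 (u t0) (v t0)) = 0"
    by (rule second) (use normals[OF u0, of "v t0"] in \<open>simp_all add: p_def q_def partials[OF u0]\<close>)
  moreover have "U t0 * p' (normal2 (u t0) (v t0)) + V t0 * q' (normal2 (u t0) (v t0)) =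
      2 * \<alpha> * \<beta> * (radial_det (u t0) * U t0 * V t0)"
    by (simp add: p'_def q'_def normal2_def minkowski_screw radial_det_def
        algebra_simps power2_eq_square sigma_cancel)
  ultimately have h2: "radial_det (u t0) * U t0 * V t0 = 0"
    using pos by simp
  \<comment> \<open>By \<open>h2\<close>, Q = 0 or one of U, V is zero; the other is then nonzero,
    and \<open>h1\<close> gives R = 0 or P = 0 respectively.\<close>
  have "merid_curv (u t0) * radial_det (u t0) * power_defect (u t0) = 0"
    using h1 h2 \<open>U t0 \<noteq> 0 \<or> V t0 \<noteq> 0\<close> by auto
  then show ?thesis
    by (simp add: u_def)
qed

lemma ruled_imp_parabolic:
  assumes "ruled z (J \<times> {0..<2 * pi})" and u: "u \<in> J"
  shows "merid_curv u * radial_det u * power_defect u = 0"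
proof -
  let ?D = "J \<times> {0..<2 * pi}"
  obtain \<R> X where part: "partition_on ?D \<R>" and X: "continuous_on ?D X" "\<And>p. p \<in> ?D \<Longrightarrow> X p \<noteq> 0"
    and leaf: "\<And>R. R \<in> \<R> \<Longrightarrow> leaf_of X R" and line: "\<And>R. R \<in> \<R> \<Longrightarrow> collinear (z ` R)"
    using assms(1) unfolding ruled_def ruling_foliation_def by blast
  \<comment> \<open>The three factors depend on \<open>u\<close> alone, so the ruling through a
    single point over \<open>u\<close> suffices.\<close>
  have p: "(u, 0) \<in> ?D"
    using u by simp
  then obtain R where R: "R \<in> \<R>" "(u, 0) \<in> R"
    using part unfolding partition_on_def by blast
  then have RD: "R \<subseteq> ?D"
    using part unfolding partition_on_def by blast
  obtain I \<gamma> where I: "is_interval I" "interior I \<noteq> {}" "\<gamma> ` I = R"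
    and \<gamma>: "\<And>t. t \<in> I \<Longrightarrow> (\<gamma> has_vector_derivative X (\<gamma> t)) (at t within I)"
    using leaf[OF R(1)] unfolding leaf_of_def by blast
  obtain t0 where t0: "t0 \<in> I" "\<gamma> t0 = (u, 0)"
    using R(2) I(3) by (metis imageE)
  have "fst (\<gamma> t) \<in> J" if "t \<in> I" for t
    using RD I(3) that by (metis image_eqI mem_Times_iff subsetD)
  moreover have "continuous_on (\<gamma> ` I) X"
    using X(1) RD I(3) by (metis continuous_on_subset)
  ultimately show ?thesis
    using parabolic_on_line[of I t0 \<gamma> X] I \<gamma> t0 X(2)[OF p] line[OF R(1)] by simp
qed

section \<open>The equation P Q R = 0 along the meridian\<close>

lemma convex_J: "convex J"
  using J(2) by (simp add: is_interval_convex)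

lemma cont_merid_curv: "u \<in> J \<Longrightarrow> isCont merid_curv u"
  and cont_power_defect: "u \<in> J \<Longrightarrow> isCont power_defect u"
  unfolding merid_curv_def power_defect_def
  by (intro continuous_intros cont_f'' cont_g'' DERIV_isCont[OF deriv_f] DERIV_isCont[OF deriv_g]
      DERIV_isCont[OF deriv_f'] DERIV_isCont[OF deriv_g']; assumption)+

lemma power_defect_deriv:
  assumes "u \<in> J"
  shows "(power_defect has_real_derivative
      \<alpha>\<^sup>2 * (f' u * g' u + f u * g'' u) + \<beta>\<^sup>2 * (g' u * f' u + g u * f'' u)) (at u)"
  unfolding power_defect_def
  by (auto intro!: derivative_eq_intros deriv_f deriv_g deriv_f' deriv_g' assms simp: algebra_simps)

lemma radial_det_deriv:
  assumes "u \<in> J"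
  shows "(radial_det has_real_derivative f'' u * g u - f u * g'' u) (at u)"
  unfolding radial_det_def
  by (auto intro!: derivative_eq_intros deriv_f deriv_g deriv_f' deriv_g' assms simp: algebra_simps)

lemma eventually_nonzero:
  fixes h :: "real \<Rightarrow> real"
  assumes "isCont h u" "h u \<noteq> 0"
  shows "\<forall>\<^sub>F x in nhds u. h x \<noteq> 0"
  using assms by (auto simp: isCont_def tendsto_at_iff_tendsto_nhds intro: tendsto_imp_eventually_ne)

lemma eventually_J: "u \<in> J \<Longrightarrow> \<forall>\<^sub>F x in nhds u. x \<in> J"
  using J(1) by (rule eventually_nhds_in_open)

lemma deriv_zero_if_eventually_zero:
  fixes h :: "real \<Rightarrow> real"
  assumes "(h has_real_derivative d) (at u)" "\<forall>\<^sub>F x in nhds u. h x = 0"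
  shows "d = 0"
proof -
  have "((\<lambda>x. 0) has_real_derivative d) (at u)"
    using assms DERIV_cong_ev[OF refl assms(2) refl] by simp
  then show ?thesis
    using DERIV_unique DERIV_const by blast
qed

lemma curv_or_power_zero:
  assumes k: "\<And>u. u \<in> J \<Longrightarrow> merid_curv u * radial_det u * power_defect u = 0" and u: "u \<in> J"
  shows "merid_curv u = 0 \<or> power_defect u = 0"
proof (rule ccontr)
  assume neg: "\<not> ?thesis"
  have "\<forall>\<^sub>F x in nhds u. merid_curv x \<noteq> 0" "\<forall>\<^sub>F x in nhds u. power_defect x \<noteq> 0"
    using neg eventually_nonzero cont_merid_curv[OF u] cont_power_defect[OF u] by auto
  then have ev: "\<forall>\<^sub>F x in nhds u. radial_det x = 0"
    using eventually_J[OF u] by eventually_elim (use k in auto)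
  have Q': "f'' u * g u - f u * g'' u = 0"
    by (rule deriv_zero_if_eventually_zero[OF radial_det_deriv[OF u] ev])
  have Q: "f' u * g u - f u * g' u = 0"
    using eventually_nhds_x_imp_x[OF ev] by (simp add: radial_det_def)
  \<comment> \<open>Q = Q' = 0 makes the velocity and the acceleration both proportional to the
    position when the latter is nonzero, which would give P = 0.\<close>
  have "f u * merid_curv u = 0" "g u * merid_curv u = 0"
    using Q Q' unfolding merid_curv_def by algebra+
  then have "f u = 0" "g u = 0"
    using neg by auto
  then show False
    using G_pos[OF u] by simp
qed

section \<open>Meridians of vanishing curvature\<close>

lemma speed_pos:
  assumes "u \<in> J"
  shows "(f' u)\<^sup>2 + (g' u)\<^sup>2 > 0"
  using E_pos[OF assms] by (auto simp: sum_power2_gt_zero_iff)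

lemma zero_deriv_imp_const:
  assumes "convex A" "\<And>u. u \<in> A \<Longrightarrow> (h has_real_derivative 0) (at u)"
  shows "\<exists>k. \<forall>u\<in>A. h u = (k :: real)"
  using assms(1)
  by (rule has_field_derivative_zero_constant) (rule has_field_derivative_at_within[OF assms(2)])

lemma straight_meridian:
  assumes P: "\<And>u. u \<in> J \<Longrightarrow> merid_curv u = 0" and u0: "u0 \<in> J" and u: "u \<in> J"
  shows "\<exists>s. f u = f u0 + s * f' u0 \<and> g u = g u0 + s * g' u0"
proof -
  define r where "r = (\<lambda>u. (f' u)\<^sup>2 + (g' u)\<^sup>2)"
  \<comment> \<open>The quotient \<open>(d u)\<^sup>2 / r u\<close> is the squared Euclidean speed
    at \<open>u0\<close> times the squared sine of the angle between the velocities at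
    \<open>u\<close> and \<open>u0\<close>; it is constant when the curvature vanishes.\<close>
  define d where "d = (\<lambda>u. f' u * g' u0 - g' u * f' u0)"
  have r: "r u > 0" if "u \<in> J" for u
    using speed_pos[OF that] by (simp add: r_def)
  have "((\<lambda>u. (d u)\<^sup>2 / r u) has_real_derivative 0) (at u)" if x: "u \<in> J" for u
  proof -
    define d' where "d' = f'' u * g' u0 - g'' u * f' u0"
    define r' where "r' = 2 * (f' u * f'' u + g' u * g'' u)"
    have "(d has_real_derivative d') (at u)"
      unfolding d_def d'_def by (auto intro!: derivative_eq_intros deriv_f' deriv_g' x)
    moreover have "(r has_real_derivative r') (at u)"
      unfolding r_def r'_def by (auto intro!: derivative_eq_intros deriv_f' deriv_g' x)
    ultimately have "((\<lambda>u. (d u)\<^sup>2 / r u) has_real_derivative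
        (2 * d u * d' * r u - (d u)\<^sup>2 * r') / (r u * r u)) (at u)"
      using r[OF x] by (auto intro!: derivative_eq_intros)
    moreover have "2 * d u * d' * r u - (d u)\<^sup>2 * r' = 0"
      using P[OF x] unfolding merid_curv_def d_def d'_def r_def r'_def by algebra
    ultimately show ?thesis
      by simp
  qed
  then have "\<exists>k. \<forall>u\<in>J. (d u)\<^sup>2 / r u = k"
    by (rule zero_deriv_imp_const[OF convex_J])
  then obtain k where "\<And>u. u \<in> J \<Longrightarrow> (d u)\<^sup>2 / r u = k"
    by blast
  moreover have "d u0 = 0"
    by (simp add: d_def)
  ultimately have d0: "d u = 0" if "u \<in> J" for u
    using u0 that r[OF that] by (metis div_0 divide_eq_0_iff less_irrefl power_zero_numeral power_eq_0_iff)
  have "((\<lambda>u. f u * g' u0 - g u * f' u0) has_real_derivative 0) (at u)" if "u \<in> J" for u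
    using d0[OF that] unfolding d_def by (auto intro!: derivative_eq_intros deriv_f deriv_g that)
  then have "\<exists>k. \<forall>u\<in>J. f u * g' u0 - g u * f' u0 = k"
    by (rule zero_deriv_imp_const[OF convex_J])
  then have h: "f u * g' u0 - g u * f' u0 = f u0 * g' u0 - g u0 * f' u0"
    using u u0 by auto
  \<comment> \<open>By \<open>h\<close> the chord from \<open>u0\<close> is parallel to the velocity
    there, and \<open>s\<close> is its Euclidean projection coefficient.\<close>
  define s where "s = ((f u - f u0) * f' u0 + (g u - g u0) * g' u0) / r u0"
  have "(f u - f u0) * r u0 = ((f u - f u0) * f' u0 + (g u - g u0) * g' u0) * f' u0"
    "(g u - g u0) * r u0 = ((f u - f u0) * f' u0 + (g u - g u0) * g' u0) * g' u0"
    using h unfolding r_def by algebra+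
  then have "f u - f u0 = s * f' u0" "g u - g u0 = s * g' u0"
    using r[OF u0] by (simp_all add: s_def field_simps)
  then show ?thesis
    by (intro exI[of _ s]) simp
qed

text \<open>The leaves are the meridians \<open>J \<times> {v}\<close>, integral curves of the
  constant field \<open>(1, 0)\<close>. They are images of one straight plane curve under the maps
  \<open>screw v\<close>, which are linear in the moving coordinates.\<close>

lemma ruled_by_meridians:
  assumes P: "\<And>u. u \<in> J \<Longrightarrow> merid_curv u = 0"
  shows "ruled z (J \<times> {0..<2 * pi})"
proof -
  let ?D = "J \<times> {0..<2 * pi}"
  obtain u0 where u0: "u0 \<in> J"
    using J(3) by blast
  have line: "collinear (z ` (J \<times> {v}))" for v
    unfolding collinear_alt
  proof (rule exI, rule exI, rule ballI)
    fix x assume "x \<in> z ` (J \<times> {v})"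
    then obtain u where u: "u \<in> J" "x = z (u, v)"
      by blast
    from straight_meridian[OF P u0 u(1)] obtain s
      where "f u = f u0 + s * f' u0" "g u = g u0 + s * g' u0"
      by blast
    then show "\<exists>c. x = z (u0, v) + c *\<^sub>R screw v (f' u0) 0 (g' u0) 0"
      by (intro exI[of _ s]) (simp add: u(2) z_screw screw_def vec_eq_iff forall_4 algebra_simps)
  qed
  have "leaf_of (\<lambda>_. (1, 0)) (J \<times> {v})" for v
    unfolding leaf_of_def
  proof (intro exI conjI ballI)
    show "is_interval J" "interior J \<noteq> {}"
      using J by (simp_all add: interior_open)
    show "(\<lambda>t. (t, v)) ` J = J \<times> {v}"
      by auto
    show "((\<lambda>t. (t, v)) has_vector_derivative (1, 0)) (at t within J)" for t
      by (auto intro!: derivative_eq_intros)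
  qed
  moreover have "closedin (top_of_set ?D) (J \<times> {v})" if "v \<in> {0..<2 * pi}" for v
  proof -
    have "J \<times> {v} = ?D \<inter> (UNIV \<times> {v})"
      using that by auto
    then show ?thesis
      by (metis closed_Times closed_UNIV closed_singleton closedin_closed_Int)
  qed
  moreover have "partition_on ?D ((\<lambda>v. J \<times> {v}) ` {0..<2 * pi})"
    using J(3) by (auto simp: partition_on_def disjoint_def)
  ultimately have "ruling_foliation z ?D ((\<lambda>v. J \<times> {v}) ` {0..<2 * pi})"
    using line unfolding ruling_foliation_def
    by (intro conjI exI[of _ "\<lambda>_. (1, 0)"]) (auto simp: zero_prod_def)
  then show ?thesis
    unfolding ruled_def by blast
qed

section \<open>Power curves\<close>

text \<open>If f = 0, then R = 0 leaves g = 0 or f' = 0. For \<sigma> = 1 already f = 0 violates G >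
  0; for \<sigma> = -1 the two alternatives violate G > 0 and E > 0. If f' = 0, then R = 0 gives g'
  = 0, against E > 0.\<close>

lemma power_defect_zeroD:
  assumes u: "u \<in> J" and R: "power_defect u = 0"
  shows "f u \<noteq> 0" "f' u \<noteq> 0"
proof -
  show f0: "f u \<noteq> 0"
  proof
    assume 0: "f u = 0"
    then have "g u = 0 \<or> f' u = 0"
      using R pos by (simp add: power_defect_def)
    then show False
      using E_pos[OF u] G_pos[OF u] sign 0 by auto
        (smt (verit) mult_nonneg_nonneg zero_le_power2)+
  qed
  show "f' u \<noteq> 0"
  proof
    assume "f' u = 0"
    then have "g' u = 0"
      using R pos f0 by (simp add: power_defect_def)
    with \<open>f' u = 0\<close> show False
      using E_pos[OF u] by simp
  qed
qed

text \<open>The candidate for the constant c. Squaring \<open>f\<close> turns the power of |f| into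
  one that is differentiable for either sign of \<open>f\<close>.\<close>

definition power_const :: "real \<Rightarrow> real" where
  "power_const u = g u * ((f u)\<^sup>2) powr (\<beta>\<^sup>2 / \<alpha>\<^sup>2 / 2)"

lemma power_const_deriv:
  assumes u: "u \<in> J" and R: "power_defect u = 0"
  shows "(power_const has_real_derivative 0) (at u)"
proof -
  define k where "k = \<beta>\<^sup>2 / \<alpha>\<^sup>2 / 2"
  have f0: "f u \<noteq> 0"
    using power_defect_zeroD[OF assms] by simp
  have "((\<lambda>u. ((f u)\<^sup>2) powr k) has_real_derivative k * ((f u)\<^sup>2) powr (k - 1) * (2 * f u * f' u)) (at u)"
    by (rule DERIV_chain2[where f = "\<lambda>x. x powr k", OF has_real_derivative_powr])
      (use f0 in \<open>auto intro!: derivative_eq_intros deriv_f u\<close>)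
  from DERIV_mult[OF deriv_g[OF u] this]
  have "(power_const has_real_derivative
      g' u * ((f u)\<^sup>2) powr k + k * ((f u)\<^sup>2) powr (k - 1) * (2 * f u * f' u) * g u) (at u)"
    by (simp add: power_const_def[abs_def] k_def mult_ac add_ac)
  moreover have "((f u)\<^sup>2) powr k = ((f u)\<^sup>2) powr (k - 1) * (f u)\<^sup>2"
    using f0 by (simp add: powr_diff)
  then have "g' u * ((f u)\<^sup>2) powr k + k * ((f u)\<^sup>2) powr (k - 1) * (2 * f u * f' u) * g u =
      ((f u)\<^sup>2) powr (k - 1) * f u * (power_defect u / \<alpha>\<^sup>2)"
    using pos by (simp add: power_defect_def k_def field_simps power2_eq_square)
  ultimately show ?thesis
    using R by simp
qed

text \<open>Suppose P vanished somewhere. At the zero nearest to \<open>u1\<close>, continuity gives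
  R = R' = 0, and together with P = 0 this forces g = 0. But \<open>power_const\<close> is constant
  up to \<open>u1\<close>, where it is nonzero.\<close>

lemma power_meridian:
  assumes k: "\<And>u. u \<in> J \<Longrightarrow> merid_curv u * radial_det u * power_defect u = 0"
    and u1: "u1 \<in> J" "merid_curv u1 \<noteq> 0"
  shows "\<forall>u\<in>J. power_defect u = 0" "g u1 \<noteq> 0"
proof -
  \<comment> \<open>The derivative of R as an explicit expression, whose continuity is then
    available.\<close>
  define R' where "R' = (\<lambda>u. \<alpha>\<^sup>2 * (f' u * g' u + f u * g'' u) + \<beta>\<^sup>2 * (g' u * f' u + g u * f'' u))"
  note PR = curv_or_power_zero[OF k]
  have R'0: "R' u = 0" if "u \<in> J" "merid_curv u \<noteq> 0" for u
  proof -
    have "\<forall>\<^sub>F x in nhds u. power_defect x = 0"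
      using eventually_J[OF that(1)] eventually_nonzero[OF cont_merid_curv[OF that(1)] that(2)]
      by eventually_elim (use PR in auto)
    then show ?thesis
      using deriv_zero_if_eventually_zero[OF power_defect_deriv[OF that(1)]] by (simp add: R'_def)
  qed
  \<comment> \<open>If g = 0 at \<open>u1\<close>, then R = 0 gives g' = 0 and R' = 0 gives g'' = 0,
    so P would vanish there.\<close>
  show g1: "g u1 \<noteq> 0"
  proof
    assume "g u1 = 0"
    moreover have R: "power_defect u1 = 0"
      using PR u1 by blast
    moreover note f0 = power_defect_zeroD[OF u1(1) R]
    ultimately have g': "g' u1 = 0"
      using pos by (simp add: power_defect_def)
    then have "g'' u1 = 0"
      using R'0[OF u1] \<open>g u1 = 0\<close> f0 pos by (simp add: R'_def)
    then show False
      using u1(2) g' by (simp add: merid_curv_def)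
  qed
  have "merid_curv q \<noteq> 0" if q: "q \<in> J" for q
  proof
    assume q0: "merid_curv q = 0"
    define T where "T = {t \<in> closed_segment q u1. merid_curv t = 0}"
    have segJ: "closed_segment q u1 \<subseteq> J"
      using convex_J q u1(1) by (simp add: closed_segment_subset)
    have "continuous_on (closed_segment q u1) merid_curv"
      using segJ cont_merid_curv by (intro continuous_at_imp_continuous_on) blast
    then have "closed T"
      unfolding T_def by (intro continuous_closed_preimage_constant) simp_all
    moreover have "q \<in> T"
      using q0 by (simp add: T_def)
    ultimately obtain u0 where u0: "u0 \<in> T" "\<And>y. y \<in> T \<Longrightarrow> dist u1 u0 \<le> dist u1 y"
      using distance_attains_inf[of T u1] by blast
    have u0': "u0 \<in> closed_segment q u1" "merid_curv u0 = 0" "u0 \<in> J" "u0 \<noteq> u1"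
      using u0(1) segJ u1(2) by (auto simp: T_def)
    have sub: "closed_segment u0 u1 \<subseteq> closed_segment q u1"
      using u0'(1) by (simp add: subset_closed_segment)
    have S: "u \<in> J" "merid_curv u \<noteq> 0" if u: "u \<in> open_segment u0 u1" for u
    proof -
      have uc: "u \<in> closed_segment q u1"
        using that sub segment_open_subset_closed by blast
      then show "u \<in> J"
        using segJ by blast
      have "dist u1 u < dist u1 u0"
        using dist_in_open_segment[OF u] by (simp add: dist_commute)
      then show "merid_curv u \<noteq> 0"
        using u0(2)[of u] uc by (auto simp: T_def)
    qed
    have cl: "closure (open_segment u0 u1) = closed_segment u0 u1"
      using u0'(4) by simp
    have clJ: "closed_segment u0 u1 \<subseteq> J"
      using sub segJ by blast
    have R: "power_defect u = 0" if "u \<in> closed_segment u0 u1" for u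
      using continuous_constant_on_closure[of "open_segment u0 u1" power_defect 0 u]
      unfolding cl using that S PR clJ cont_power_defect by (meson continuous_at_imp_continuous_on subsetD)
    have "isCont R' u" if "u \<in> J" for u
      unfolding R'_def
      by (intro continuous_intros cont_f'' cont_g'' DERIV_isCont[OF deriv_f] DERIV_isCont[OF deriv_g]
          DERIV_isCont[OF deriv_f'] DERIV_isCont[OF deriv_g'] that)
    then have "R' u0 = 0"
      using continuous_constant_on_closure[of "open_segment u0 u1" R' 0 u0]
      unfolding cl using S R'0 clJ by (meson continuous_at_imp_continuous_on subsetD ends_in_segment(1))
    moreover have R0: "power_defect u0 = 0"
      by (rule R) simp
    \<comment> \<open>Eliminating g' and g'' by R = R' = 0 expresses P through g: a power curve is
      inflected only where g = 0.\<close>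
    ultimately have "\<alpha>\<^sup>2 * \<alpha>\<^sup>2 * (f u0)\<^sup>2 * merid_curv u0 = (\<alpha>\<^sup>2 + \<beta>\<^sup>2) * \<beta>\<^sup>2 * (f' u0) ^ 3 * g u0"
      unfolding R'_def power_defect_def merid_curv_def by algebra
    moreover have "\<alpha>\<^sup>2 + \<beta>\<^sup>2 \<noteq> 0"
      using pos by (simp add: sum_power2_eq_zero_iff)
    ultimately have "g u0 = 0"
      using u0'(2) pos power_defect_zeroD(2)[OF u0'(3) R0] by simp
    moreover have "\<exists>c. \<forall>u\<in>closed_segment u0 u1. power_const u = c"
      using R clJ by (intro zero_deriv_imp_const power_const_deriv) auto
    then have "power_const u0 = power_const u1"
      by auto
    ultimately have "power_const u1 = 0"
      by (simp add: power_const_def)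
    then show False
      using g1 power_defect_zeroD(1)[OF u1(1) R] by (simp add: power_const_def)
  qed
  then show "\<forall>u\<in>J. power_defect u = 0"
    using PR by blast
qed

section \<open>Reparametrising the meridian by the absolute value of f\<close>

lemma deriv_funpow_cmult:
  assumes "smooth_on h A" "open A" "x \<in> A"
  shows "(deriv ^^ n) (\<lambda>x. c * h x) x = c * (deriv ^^ n) h x"
  using assms(3)
proof (induction n arbitrary: x)
  case (Suc n)
  have "\<forall>\<^sub>F y in nhds x. (deriv ^^ n) (\<lambda>x. c * h x) y = c * (deriv ^^ n) h y"
    using eventually_nhds_in_open[OF assms(2) Suc.prems] by eventually_elim (rule Suc.IH)
  then have "deriv ((deriv ^^ n) (\<lambda>x. c * h x)) x = deriv (\<lambda>y. c * (deriv ^^ n) h y) x"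
    by (rule deriv_cong_ev) simp
  also have "\<dots> = c * deriv ((deriv ^^ n) h) x"
    using assms(1) Suc.prems
    by (intro deriv_cmult) (simp add: smooth_on_def field_differentiable_def real_differentiable_def)
  finally show ?case
    by simp
qed simp

lemma smooth_on_cmult:
  assumes "smooth_on h A" "open A"
  shows "smooth_on (\<lambda>x. c * h x) A"
  unfolding smooth_on_def
proof (intro allI ballI)
  fix n x assume x: "x \<in> A"
  have "(\<lambda>x. c * (deriv ^^ n) h x) differentiable at x"
    using assms(1) x by (simp add: smooth_on_def)
  moreover obtain e where "e > 0" "ball x e \<subseteq> A"
    using assms(2) x open_contains_ball by blast
  ultimately show "(deriv ^^ n) (\<lambda>x. c * h x) differentiable at x"
    by (elim differentiable_transform_within[where d = e])
      (auto simp: deriv_funpow_cmult[OF assms] subset_iff dist_commute)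
qed

abbreviation is_power_meridian :: "real \<Rightarrow> bool" where
  "is_power_meridian c \<equiv> meridian_given_by f g J (\<lambda>u. u) (\<lambda>u. c * u powr (- (\<beta>\<^sup>2 / \<alpha>\<^sup>2))) {0<..}"

text \<open>The function \<open>f\<close> has no zero, so it keeps its sign on \<open>J\<close>, and
  its derivative has no zero either. Hence |f| is a regular parameter, and constancy of
  \<open>power_const\<close> expresses g through it.\<close>

lemma power_defect_zero_imp_power_meridian:
  assumes R: "\<forall>u\<in>J. power_defect u = 0" and u1: "u1 \<in> J" "g u1 \<noteq> 0"
  shows "\<exists>c. c \<noteq> 0 \<and> is_power_meridian c"
proof -
  define m where "m = \<beta>\<^sup>2 / \<alpha>\<^sup>2"
  have "\<exists>c. \<forall>u\<in>J. power_const u = c"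
    using R by (intro zero_deriv_imp_const power_const_deriv convex_J) auto
  then obtain c where c: "\<And>u. u \<in> J \<Longrightarrow> power_const u = c"
    by blast
  have f0: "f u \<noteq> 0" "f' u \<noteq> 0" if "u \<in> J" for u
    using power_defect_zeroD that R by blast+
  have c0: "c \<noteq> 0"
    using c[OF u1(1)] u1(2) f0(1)[OF u1(1)] by (auto simp: power_const_def)
  define \<epsilon> :: real where "\<epsilon> = (if f u1 > 0 then 1 else -1)"
  have "connected (f ` J)"
    using J(2) deriv_f by (intro connected_continuous_image continuous_at_imp_continuous_on)
      (auto simp: is_interval_connected intro: DERIV_isCont)
  then have \<phi>_pos: "\<epsilon> * f u > 0" if u: "u \<in> J" for u
    using connectedD_interval[of "f ` J" "f u" "f u1" 0] connectedD_interval[of "f ` J" "f u1" "f u" 0]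
      f0(1) u u1(1) by (force simp: \<epsilon>_def not_less)
  have "smooth_on (\<lambda>u. \<epsilon> * f u) J"
    by (rule smooth_on_cmult[OF smooth(1) J(1)])
  moreover have "\<forall>u\<in>J. deriv (\<lambda>u. \<epsilon> * f u) u \<noteq> 0"
    using DERIV_imp_deriv[OF DERIV_cmult[OF deriv_f]] f0(2) by (simp add: \<epsilon>_def)
  moreover have "g u = c * (\<epsilon> * f u) powr (- m)" if u: "u \<in> J" for u
  proof -
    have "(f u)\<^sup>2 = (\<epsilon> * f u) powr 2"
      using \<phi>_pos[OF u] by (simp add: \<epsilon>_def)
    then have "((f u)\<^sup>2) powr (m / 2) = (\<epsilon> * f u) powr m"
      by (simp add: powr_powr)
    moreover have "(\<epsilon> * f u) powr m * inverse ((\<epsilon> * f u) powr m) = 1"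
      using \<phi>_pos[OF u] by (intro right_inverse) (metis less_irrefl powr_eq_0_iff)
    ultimately show ?thesis
      by (simp add: powr_minus mult.assoc power_const_def flip: c[OF u] m_def)
  qed
  ultimately have "is_power_meridian c"
    unfolding meridian_given_by_def m_def using \<phi>_pos
    by (intro bexI[of _ \<epsilon>] exI[of _ "\<lambda>u. \<epsilon> * f u"]) (auto simp: \<epsilon>_def)
  then show ?thesis
    using c0 by blast
qed

text \<open>By the chain rule both terms of R are multiples of \<epsilon> c \<phi>^(-m) \<phi>',
  with factors -\<alpha>^2 m and \<beta>^2 that cancel for m = \<beta>^2/\<alpha>^2.\<close>

lemma power_meridian_imp_power_defect_zero:
  assumes mer: "is_power_meridian c" and u: "u \<in> J"
  shows "power_defect u = 0"
proof -
  define m where "m = \<beta>\<^sup>2 / \<alpha>\<^sup>2"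
  obtain \<epsilon> \<phi> where \<phi>: "smooth_on \<phi> J" "\<phi> ` J \<subseteq> {0<..}"
    and fg: "\<forall>u\<in>J. f u = \<epsilon> * \<phi> u \<and> g u = c * \<phi> u powr (- m)"
    using mer unfolding meridian_given_by_def m_def by blast
  have \<phi>_pos: "\<phi> u > 0"
    using \<phi>(2) u by auto
  have "\<phi> differentiable at u"
    using \<phi>(1)[unfolded smooth_on_def, rule_format, of u 0] u by simp
  then obtain d where d: "(\<phi> has_real_derivative d) (at u)"
    unfolding real_differentiable_def by blast
  have "(f has_real_derivative \<epsilon> * d) (at u)"
    by (rule has_field_derivative_transform_within_open[OF DERIV_cmult[OF d] J(1) u]) (simp add: fg)
  then have f': "f' u = \<epsilon> * d"
    by (rule DERIV_imp_deriv)
  have "((\<lambda>u. c * \<phi> u powr (- m)) has_real_derivative c * (- m * \<phi> u powr (- m - 1) * d)) (at u)"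
    by (rule DERIV_cmult[OF DERIV_chain2[where f = "\<lambda>x. x powr (- m)", OF has_real_derivative_powr d]])
      (use \<phi>_pos in simp)
  then have "(g has_real_derivative c * (- m * \<phi> u powr (- m - 1) * d)) (at u)"
    by (rule has_field_derivative_transform_within_open[OF _ J(1) u]) (simp add: fg)
  then have g': "g' u = c * (- m * \<phi> u powr (- m - 1) * d)"
    by (rule DERIV_imp_deriv)
  have "\<phi> u powr (- m) = \<phi> u powr (- m - 1) * \<phi> u"
    using \<phi>_pos by (simp add: powr_diff)
  then show ?thesis
    using pos by (simp add: power_defect_def f' g' fg u m_def field_simps)
qed

section \<open>The equivalence for both types\<close>

lemma parabolic_iff:
  "consists_of_parabolic_points z (J \<times> {0..<2 * pi}) \<longleftrightarrow>
     ruled z (J \<times> {0..<2 * pi}) \<or> (\<exists>c. c \<noteq> 0 \<and> is_power_meridian c)"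
proof -
  have "consists_of_parabolic_points z (J \<times> {0..<2 * pi}) \<longleftrightarrow>
      (\<forall>u\<in>J. merid_curv u * radial_det u * power_defect u = 0)"
    by (force simp: consists_of_parabolic_points_def parabolic_point_iff)
  also have "\<dots> \<longleftrightarrow> ruled z (J \<times> {0..<2 * pi}) \<or> (\<exists>c. c \<noteq> 0 \<and> is_power_meridian c)"
  proof
    assume k: "\<forall>u\<in>J. merid_curv u * radial_det u * power_defect u = 0"
    show "ruled z (J \<times> {0..<2 * pi}) \<or> (\<exists>c. c \<noteq> 0 \<and> is_power_meridian c)"
    proof (cases "\<forall>u\<in>J. merid_curv u = 0")
      case True
      then show ?thesis
        using ruled_by_meridians by blast
    next
      case False
      then obtain u1 where u1: "u1 \<in> J" "merid_curv u1 \<noteq> 0"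
        by blast
      with k have "\<forall>u\<in>J. power_defect u = 0" "g u1 \<noteq> 0"
        using power_meridian[OF _ u1] by blast+
      then show ?thesis
        using power_defect_zero_imp_power_meridian u1(1) by blast
    qed
  qed (use ruled_imp_parabolic power_meridian_imp_power_defect_zero in auto)
  finally show ?thesis .
qed

end

theorem theorem3p4:
  fixes \<alpha> \<beta> :: real and f g :: "real \<Rightarrow> real" and J :: "real set" and z :: surface
  assumes "\<alpha> > 0" and "\<beta> > 0"
    and "open J" and "is_interval J" and "J \<noteq> {}"
    and "general_rotational_first_type \<alpha> \<beta> J f g z \<or> general_rotational_second_type \<alpha> \<beta> J f g z"
  defines "D \<equiv> J \<times> {0..<2 * pi}"
  shows "consists_of_parabolic_points z D \<longleftrightarrow>
      developable_ruled z D \<or>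
      non_developable_ruled z D \<or>
      (\<not> ruled z D \<and>
       (\<exists>c. c \<noteq> 0 \<and>
          meridian_given_by f g J (\<lambda>u. u) (\<lambda>u. c * u powr (- (\<beta>\<^sup>2 / \<alpha>\<^sup>2))) {0<..}))"
proof -
  have ch: "((\<lambda>v. cosh (\<beta> * v)) has_real_derivative \<beta> * sinh (\<beta> * v)) (at v)"
    and sh: "((\<lambda>v. sinh (\<beta> * v)) has_real_derivative \<beta> * cosh (\<beta> * v)) (at v)" for v
    by (auto intro!: derivative_eq_intros)
  have "consists_of_parabolic_points z D \<longleftrightarrow> ruled z D \<or>
      (\<exists>c. c \<noteq> 0 \<and> meridian_given_by f g J (\<lambda>u. u) (\<lambda>u. c * u powr (- (\<beta>\<^sup>2 / \<alpha>\<^sup>2))) {0<..})"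
    using assms(6)
  proof
    assume "general_rotational_first_type \<alpha> \<beta> J f g z"
    then have "rotational_surface \<alpha> \<beta> 1 (\<lambda>v. cosh (\<beta> * v)) (\<lambda>v. sinh (\<beta> * v)) f g J z"
      using assms(1-5) ch sh
      by unfold_locales (auto simp: general_rotational_first_type_def rotational1_def cosh_square_eq)
    then show ?thesis
      unfolding D_def by (rule rotational_surface.parabolic_iff)
  next
    assume "general_rotational_second_type \<alpha> \<beta> J f g z"
    then have "rotational_surface \<alpha> \<beta> (-1) (\<lambda>v. sinh (\<beta> * v)) (\<lambda>v. cosh (\<beta> * v)) f g J z"
      using assms(1-5) ch sh
      by unfold_locales (auto simp: general_rotational_second_type_def rotational2_def cosh_square_eq)
    then show ?thesis
      unfolding D_def by (rule rotational_surface.parabolic_iff)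
  qed
  \<comment> \<open>Cases (i) and (ii) together say ruled; case (iii) is the power curve alternative
    with the overlap removed, which leaves the disjunction unchanged.\<close>
  moreover have "ruled z D \<longleftrightarrow> developable_ruled z D \<or> non_developable_ruled z D"
    by (auto simp: developable_ruled_def non_developable_ruled_def ruled_def)
  ultimately show ?thesis
    by blast
qed

end
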